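(* Fix $t>0$, $\theta>0$, $\mu\in\mathbb{R}$ and $\sigma>0$. For $x_0\in\mathbb{R}$ let $\gamma_{x_0}$ be the Gaussian probability measure on $\mathbb{R}$ with mean $m_t=x_0e^{-\theta t}+\mu(1-e^{-\theta t})$ and variance $\sigma_t^2=\frac{\sigma^2}{2\theta}\left(1-e^{-2\theta t}\right)$. For $n\in\mathbb{N}$ define $T_n:\mathbb{R}^n\to\mathbb{R}$ by $$T_n(z_1,\dots,z_n)=e^{\theta t}\,\frac{\sum_{k=1}^n z_k}{n}-\mu e^{\theta t}(1-e^{-\theta t}).$$ Then the estimators $T^{(0)}:\mathbb{R}^{\infty}\to\mathbb{R}$ and $T^{(1)}:\mathbb{R}^{\infty}\to\mathbb{R}$ defined by $$T^{(0)}((z_k)_{k\in\mathbb{N}})=\liminf_{n\to\infty}T_n(z_1,\dots,z_n)\quad\text{and}\quad T^{(1)}((z_k)_{k\in\mathbb{N}})=\limsup_{n\to\infty}T_n(z_1,\dots,z_n)$$ are infinite-sample consistent estimators of the parameter $x_0$ (the underlying asset initial price) for the family of probability measures $(\gamma_{x_0}^{\infty})_{x_0\in\mathbb{R}}$.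
   Context: $\mathbb{R}^\infty=\mathbb{R}^{\mathbb{N}}$ is the space of real sequences $(z_k)_{k\in\mathbb{N}}$, $\mathbb{N}=\{1,2,\dots\}$, with its Borel $\sigma$-algebra; for a Borel probability measure $\gamma$ on $\mathbb{R}$, $\gamma^{\infty}$ denotes the infinite product measure $\gamma\times\gamma\times\cdots$ on $\mathbb{R}^\infty$. Given a family $(\gamma_\vartheta)_{\vartheta\in\mathbb{R}}$ of Borel probability measures on $\mathbb{R}$, a Borel measurable function $T:\mathbb{R}^\infty\to\mathbb{R}$ is called an infinite-sample consistent estimator of the parameter $\vartheta$ for the family $(\gamma_\vartheta^\infty)_{\vartheta\in\mathbb{R}}$ if $\gamma_\vartheta^\infty(\{(z_k)_{k\in\mathbb{N}}\in\mathbb{R}^\infty: T((z_k)_{k\in\mathbb{N}})=\vartheta\})=1$ for every $\vartheta\in\mathbb{R}$. (The measure $\gamma_{x_0}$ is the law at time $t$ of the Ornstein-Uhlenbeck process $x_t=x_0e^{-\theta t}+\mu(1-e^{-\theta t})+\sigma\int_0^te^{-\theta(t-s)}dW_s$ with $W$ a Wiener process; the claim only uses $\gamma_{x_0}$ as defined in it.)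
   Formalization: The lower and upper limits can be infinite (e.g. for z_k = k), so T^(0) and T^(1) are not real-valued everywhere as defined; here they take an arbitrary fixed real value c wherever the limit is infinite, and the claim is stated for every choice of c. *)

theory Defs
  imports "HOL-Probability.Probability"
begin

text \<open>
  Points of the sequence space are functions \<open>z :: nat \<Rightarrow> real\<close>; the coordinate written
  \<open>z\<^sub>k\<close> with \<open>k \<ge> 1\<close> in the usual 1-based notation is \<open>z (k - 1)\<close>. The type \<open>nat \<Rightarrow> real\<close> carries
  the product topology, so \<open>borel\<close> on it is the Borel sigma-algebra of the sequence space.
\<close>

definition infinite_power :: "real measure \<Rightarrow> (nat \<Rightarrow> real) measure" where
  "infinite_power \<gamma> = (\<Pi>\<^sub>M k\<in>UNIV. \<gamma>)"

definition borel_prob_measure :: "real measure \<Rightarrow> bool" where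
  "borel_prob_measure \<gamma> \<longleftrightarrow> prob_space \<gamma> \<and> sets \<gamma> = sets borel"

definition infinite_sample_consistent ::
    "(real \<Rightarrow> real measure) \<Rightarrow> ((nat \<Rightarrow> real) \<Rightarrow> real) \<Rightarrow> bool" where
  "infinite_sample_consistent \<gamma> T \<longleftrightarrow>
     (\<forall>p. borel_prob_measure (\<gamma> p)) \<and>
     T \<in> borel_measurable borel \<and>
     (\<forall>p. emeasure (infinite_power (\<gamma> p)) {z. T z = p} = 1)"

text \<open>The second argument is the variance, whereas \<open>normal_density\<close> takes the standard deviation.\<close>

definition gaussian_measure :: "real \<Rightarrow> real \<Rightarrow> real measure" where
  "gaussian_measure m v = density lborel (\<lambda>x. ennreal (normal_density m (sqrt v) x))"

definition ou_mean :: "real \<Rightarrow> real \<Rightarrow> real \<Rightarrow> real \<Rightarrow> real" where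
  "ou_mean t \<theta> \<mu> x0 = x0 * exp (- \<theta> * t) + \<mu> * (1 - exp (- \<theta> * t))"

definition ou_variance :: "real \<Rightarrow> real \<Rightarrow> real \<Rightarrow> real" where
  "ou_variance t \<theta> \<sigma> = \<sigma>\<^sup>2 / (2 * \<theta>) * (1 - exp (- 2 * \<theta> * t))"

definition ou_law :: "real \<Rightarrow> real \<Rightarrow> real \<Rightarrow> real \<Rightarrow> real \<Rightarrow> real measure" where
  "ou_law t \<theta> \<mu> \<sigma> x0 = gaussian_measure (ou_mean t \<theta> \<mu> x0) (ou_variance t \<theta> \<sigma>)"

text \<open>
  The \<open>n\<close>-sample estimator, as a function of the first \<open>n\<close> coordinates of a sequence. It is meant
  for \<open>n \<ge> 1\<close>; the value at \<open>n = 0\<close> does not affect the limits below.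
\<close>

definition sample_estimator :: "real \<Rightarrow> real \<Rightarrow> real \<Rightarrow> nat \<Rightarrow> (nat \<Rightarrow> real) \<Rightarrow> real" where
  "sample_estimator t \<theta> \<mu> n z =
     exp (\<theta> * t) * ((\<Sum>k<n. z k) / real n) - \<mu> * exp (\<theta> * t) * (1 - exp (- \<theta> * t))"

text \<open>
  The lower and upper limits of a real sequence live in the extended reals. To obtain real-valued
  estimators, an arbitrary real \<open>c\<close> is used as the value wherever the limit is infinite.
\<close>

definition real_or :: "real \<Rightarrow> ereal \<Rightarrow> real" where
  "real_or c x = (if \<bar>x\<bar> = \<infinity> then c else real_of_ereal x)"

definition T_liminf :: "real \<Rightarrow> real \<Rightarrow> real \<Rightarrow> real \<Rightarrow> (nat \<Rightarrow> real) \<Rightarrow> real" where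
  "T_liminf c t \<theta> \<mu> z = real_or c (liminf (\<lambda>n. ereal (sample_estimator t \<theta> \<mu> n z)))"

definition T_limsup :: "real \<Rightarrow> real \<Rightarrow> real \<Rightarrow> real \<Rightarrow> (nat \<Rightarrow> real) \<Rightarrow> real" where
  "T_limsup c t \<theta> \<mu> z = real_or c (limsup (\<lambda>n. ereal (sample_estimator t \<theta> \<mu> n z)))"

end

theory Submission imports Defs begin

text \<open>Exchanging sum and integral bounds the expectation of the sum of all fourth powers by
  the sum of \<open>b\<close>. A nonnegative function with finite integral is finite almost
  everywhere, so for almost every \<open>x\<close> the fourth powers form a convergent series and
  their terms vanish in the limit.\<close>

lemma AE_tendsto_zero_if_power4_summable:
  fixes Y :: "nat \<Rightarrow> 'a \<Rightarrow> real"
  assumes [measurable]: "\<And>n. Y n \<in> borel_measurable M"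
    and bound: "\<And>n. (\<integral>\<^sup>+x. ennreal (Y n x ^ 4) \<partial>M) \<le> ennreal (b n)"
    and nonneg: "\<And>n. 0 \<le> b n" and sum: "summable b"
  shows "AE x in M. (\<lambda>n. Y n x) \<longlonglongrightarrow> 0"
proof -
  have "(\<integral>\<^sup>+x. (\<Sum>n. ennreal (Y n x ^ 4)) \<partial>M) = (\<Sum>n. \<integral>\<^sup>+x. ennreal (Y n x ^ 4) \<partial>M)"
    by (rule nn_integral_suminf) measurable
  also have "\<dots> \<le> (\<Sum>n. ennreal (b n))"
    by (intro suminf_le bound summableI)
  also have "\<dots> = ennreal (\<Sum>n. b n)"
    by (rule suminf_ennreal2[OF nonneg sum])
  also have "\<dots> < \<infinity>" by simp
  finally have "(\<integral>\<^sup>+x. (\<Sum>n. ennreal (Y n x ^ 4)) \<partial>M) \<noteq> \<infinity>" by simp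
  then have "AE x in M. (\<Sum>n. ennreal (Y n x ^ 4)) \<noteq> \<infinity>"
    by (intro nn_integral_PInf_AE) measurable
  then show ?thesis
  proof eventually_elim
    case (elim x)
    then have "summable (\<lambda>n. Y n x ^ 4)"
      by (intro summable_suminf_not_top) auto
    then have "(\<lambda>n. Y n x ^ 4) \<longlonglongrightarrow> 0" by (rule summable_LIMSEQ_zero)
    \<comment> \<open>The fourth root recovers only the absolute value, which is enough for
      convergence to 0.\<close>
    then have "(\<lambda>n. root 4 (Y n x ^ 4)) \<longlonglongrightarrow> root 4 0" by (rule tendsto_real_root)
    moreover have "root 4 (Y n x ^ 4) = \<bar>Y n x\<bar>" for n
      using real_root_power_cancel[of 4 "\<bar>Y n x\<bar>"] by (simp add: power_even_abs)
    ultimately have "(\<lambda>n. \<bar>Y n x\<bar>) \<longlonglongrightarrow> 0" by simp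
    then show ?case by (rule tendsto_rabs_zero_cancel)
  qed
qed

text \<open>
  A sum of independent Gaussian variables is Gaussian, which gives the fourth central moment of
  the sample mean exactly; being of order \<open>1 / n\<^sup>2\<close> it is summable, unlike the variance.
\<close>

lemma (in prob_space) normal_strong_law:
  assumes indep: "indep_vars (\<lambda>_. borel) X (UNIV :: nat set)"
    and s: "0 < s"
    and normal: "\<And>i. distributed M lborel (X i) (normal_density m s)"
  shows "AE x in M. (\<lambda>n. (\<Sum>k<n. X k x) / real n) \<longlonglongrightarrow> m"
proof -
  have meas [measurable]: "X i \<in> borel_measurable M" for i
    using indep by (auto simp: indep_vars_def)
  \<comment> \<open>Centred sample mean of \<open>Suc n\<close> variables; the shift avoids division
    by zero and is undone at the end by \<open>LIMSEQ_imp_Suc\<close>.\<close>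
  define Y where "Y = (\<lambda>n x. (\<Sum>k<Suc n. X k x) / real (Suc n) - m)"
  have [measurable]: "Y n \<in> borel_measurable M" for n
    unfolding Y_def by measurable
  have moment: "(\<integral>\<^sup>+x. ennreal (Y n x ^ 4) \<partial>M) \<le> ennreal (3 * s ^ 4 * inverse (real (Suc n) ^ 2))" for n
  proof -
    define N where "N = real (Suc n)"
    have N: "0 < N" unfolding N_def by simp
    \<comment> \<open>Standard deviation of the sum of \<open>N\<close> independent variables, each
      of variance \<open>s\<^sup>2\<close>.\<close>
    define r where "r = sqrt (N * s\<^sup>2)"
    have r: "0 < r" using N s unfolding r_def by simp
    have "distributed M lborel (\<lambda>x. \<Sum>i<Suc n. X i x)
        (normal_density (\<Sum>i<Suc n. m) (sqrt (\<Sum>i<Suc n. s\<^sup>2)))"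
      by (rule sum_indep_normal[OF _ _ indep_vars_subset[OF indep] s normal]) auto
    then have S: "distributed M lborel (\<lambda>x. \<Sum>i<Suc n. X i x) (normal_density (N * m) r)"
      unfolding r_def N_def by (simp only: sum_constant card_lessThan)
    have Ydef: "Y n x ^ 4 = ((\<Sum>i<Suc n. X i x) - N * m) ^ 4 / N ^ 4" for x
    proof -
      have "Y n x = ((\<Sum>i<Suc n. X i x) - N * m) / N"
        using N unfolding Y_def N_def by (simp add: field_simps)
      then show ?thesis by (simp only: power_divide)
    qed
    have mom: "has_bochner_integral lborel (\<lambda>x. normal_density (N * m) r x * (x - N * m) ^ 4) (3 * r ^ 4)"
    proof -
      \<comment> \<open>The general even moment of order 2k at k = 2: 4! r^4 / (2^2 2!) = 3
        r^4.\<close>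
      have "fact (2 * 2) / ((2 / r\<^sup>2) ^ 2 * fact 2) = 3 * r ^ 4"
        using r by (simp add: fact_numeral field_simps flip: power_mult)
      with normal_moment_even[OF r, of "N * m" 2] show ?thesis by simp
    qed
    have "(\<integral>\<^sup>+x. ennreal (Y n x ^ 4) \<partial>M)
        = (\<integral>\<^sup>+x. ennreal (normal_density (N * m) r x) * ennreal ((x - N * m) ^ 4 / N ^ 4) \<partial>lborel)"
      unfolding Ydef by (rule distributed_nn_integral[OF S, symmetric]) measurable
    also have "\<dots> = (\<integral>\<^sup>+x. ennreal (normal_density (N * m) r x * (x - N * m) ^ 4 / N ^ 4) \<partial>lborel)"
      by (simp add: ennreal_mult'[symmetric])
    also have "\<dots> = ennreal (3 * r ^ 4 / N ^ 4)"
      using has_bochner_integral_divide_zero[OF mom, of "N ^ 4"]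
      by (subst nn_integral_eq_integral)
         (auto simp: has_bochner_integral_iff integral_nonneg_AE)
    \<comment> \<open>Independence makes r^4 grow only like N^2, so dividing by N^4 leaves the order
      N^(-2).\<close>
    also have "3 * r ^ 4 / N ^ 4 = 3 * s ^ 4 * inverse (N ^ 2)"
    proof -
      have "r ^ 4 = (r\<^sup>2)\<^sup>2" by (simp flip: power_mult)
      also have "\<dots> = N\<^sup>2 * s ^ 4" using N unfolding r_def by (simp add: power_mult_distrib flip: power_mult)
      finally show ?thesis using N by (simp add: field_simps power2_eq_square power4_eq_xxxx)
    qed
    finally show ?thesis unfolding N_def by simp
  qed
  have "AE x in M. (\<lambda>n. Y n x) \<longlonglongrightarrow> 0"
  proof (rule AE_tendsto_zero_if_power4_summable[OF _ moment])
    have "summable (\<lambda>n. inverse (real (Suc n) ^ 2))"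
      using inverse_power_summable[of 2, where 'a=real] by (subst summable_Suc_iff) simp
    then show "summable (\<lambda>n. 3 * s ^ 4 * inverse (real (Suc n) ^ 2))"
      by (rule summable_mult)
  qed auto
  then show ?thesis
  proof eventually_elim
    case (elim x)
    then have "(\<lambda>n. (\<Sum>k<Suc n. X k x) / real (Suc n)) \<longlonglongrightarrow> m"
      unfolding Y_def by (simp add: LIM_zero_iff)
    then show ?case by (rule LIMSEQ_imp_Suc)
  qed
qed

lemma prob_space_gaussian_measure:
  "0 < v \<Longrightarrow> prob_space (gaussian_measure m v)"
  unfolding gaussian_measure_def by (rule prob_space_normal_density) simp

lemma sets_gaussian_measure [simp]: "sets (gaussian_measure m v) = sets borel"
  by (simp add: gaussian_measure_def)

text \<open>The index set is countable and the reals are second countable, so the product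
  sigma-algebra is the Borel one of the product topology. This links \<open>infinite_power\<close>
  to estimators whose measurability is stated over \<open>borel\<close>.\<close>

lemma sets_infinite_power:
  assumes "sets \<gamma> = sets borel"
  shows "sets (infinite_power \<gamma>) = sets borel"
proof -
  have "sets (infinite_power \<gamma>) = sets (\<Pi>\<^sub>M k\<in>(UNIV :: nat set). (borel :: real measure))"
    unfolding infinite_power_def using assms by (intro sets_PiM_cong) auto
  then show ?thesis by (simp only: sets_PiM_equal_borel)
qed

lemma prob_space_infinite_power: "prob_space \<gamma> \<Longrightarrow> prob_space (infinite_power \<gamma>)"
  unfolding infinite_power_def by (rule prob_space_PiM)

lemma distr_infinite_power_component:
  assumes "prob_space \<gamma>" "sets \<gamma> = sets borel"
  shows "distr (infinite_power \<gamma>) borel (\<lambda>z. z i) = \<gamma>"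
proof -
  have "distr (infinite_power \<gamma>) borel (\<lambda>z. z i) = distr (infinite_power \<gamma>) \<gamma> (\<lambda>z. z i)"
    using assms(2) by (intro distr_cong) auto
  also have "\<dots> = \<gamma>"
    unfolding infinite_power_def using assms(1)
    by (intro distr_PiM_component[where M = "\<lambda>_. \<gamma>"]) auto
  finally show ?thesis .
qed

text \<open>Independence amounts to the joint law being the product of the marginals. The joint law
  of all coordinates is the law of the identity, that is \<open>infinite_power \<gamma>\<close>, and
  each marginal is \<gamma>.\<close>

lemma infinite_power_indep_vars:
  assumes "prob_space \<gamma>" "sets \<gamma> = sets borel"
  shows "prob_space.indep_vars (infinite_power \<gamma>) (\<lambda>_. borel) (\<lambda>i z. z i) UNIV"
proof -
  interpret P: prob_space "infinite_power \<gamma>"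
    by (rule prob_space_infinite_power) fact
  have coord: "(\<lambda>z. z i) \<in> borel_measurable (infinite_power \<gamma>)" for i
    using measurable_product_coordinates
    by (simp add: measurable_cong_sets[OF sets_infinite_power[OF assms(2)] refl])
  have "distr (infinite_power \<gamma>) (\<Pi>\<^sub>M i\<in>UNIV. borel) (\<lambda>z. z) = infinite_power \<gamma>"
    using sets_infinite_power[OF assms(2)] by (intro distr_id2) (simp add: sets_PiM_equal_borel)
  then have "distr (infinite_power \<gamma>) (\<Pi>\<^sub>M i\<in>UNIV. borel) (\<lambda>z. \<lambda>i\<in>UNIV. z i)
      = (\<Pi>\<^sub>M i\<in>UNIV. distr (infinite_power \<gamma>) borel (\<lambda>z. z i))"
    by (simp only: distr_infinite_power_component[OF assms] restrict_UNIV)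
       (simp only: infinite_power_def)
  then show ?thesis
    using coord by (subst P.indep_vars_iff_distr_eq_PiM) auto
qed

text \<open>Under the product measure the coordinates are independent with common normal law, so the
  strong law applies to them with standard deviation \<open>sqrt v\<close>.\<close>

lemma gaussian_infinite_power_mean:
  assumes "0 < v"
  shows "AE z in infinite_power (gaussian_measure m v).
    (\<lambda>n. (\<Sum>k<n. z k) / real n) \<longlonglongrightarrow> m"
proof -
  let ?\<gamma> = "gaussian_measure m v"
  have \<gamma>: "prob_space ?\<gamma>" by (rule prob_space_gaussian_measure) fact
  interpret P: prob_space "infinite_power ?\<gamma>" by (rule prob_space_infinite_power) fact
  have indep: "P.indep_vars (\<lambda>_. borel) (\<lambda>i z. z i) UNIV"
    using \<gamma> by (rule infinite_power_indep_vars) simp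
  have "distributed (infinite_power ?\<gamma>) lborel (\<lambda>z. z i) (normal_density m (sqrt v))" for i
  proof -
    \<comment> \<open>A pushforward sees only the sigma-algebra of its target, which
      \<open>lborel\<close> shares with \<open>borel\<close>.\<close>
    have "distr (infinite_power ?\<gamma>) lborel (\<lambda>z. z i) = ?\<gamma>"
      using distr_infinite_power_component[OF \<gamma>, of i] by (simp cong: distr_cong)
    moreover have "(\<lambda>z. z i) \<in> borel_measurable (infinite_power ?\<gamma>)"
      using indep by (auto simp: P.indep_vars_def)
    ultimately show ?thesis by (simp add: distributed_def gaussian_measure_def)
  qed
  then show ?thesis using assms by (intro P.normal_strong_law[OF indep, of "sqrt v"]) auto
qed

lemma ou_variance_pos:
  assumes "0 < t" "0 < \<theta>" "0 < \<sigma>"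
  shows "0 < ou_variance t \<theta> \<sigma>"
  using assms unfolding ou_variance_def by (intro mult_pos_pos divide_pos_pos) auto

text \<open>The estimator applies to the sample mean the affine inverse of the map from
  \<open>x0\<close> to \<open>ou_mean\<close>; continuity carries the strong law over.\<close>

lemma sample_estimator_AE_tendsto:
  assumes "0 < t" "0 < \<theta>" "0 < \<sigma>"
  shows "AE z in infinite_power (ou_law t \<theta> \<mu> \<sigma> x0).
    (\<lambda>n. sample_estimator t \<theta> \<mu> n z) \<longlonglongrightarrow> x0"
proof -
  from gaussian_infinite_power_mean[OF ou_variance_pos[OF assms], of "ou_mean t \<theta> \<mu> x0"]
  show ?thesis unfolding ou_law_def
  proof eventually_elim
    case (elim z)
    then have "(\<lambda>n. sample_estimator t \<theta> \<mu> n z) \<longlonglongrightarrow>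
        exp (\<theta> * t) * ou_mean t \<theta> \<mu> x0 - \<mu> * exp (\<theta> * t) * (1 - exp (- \<theta> * t))"
      unfolding sample_estimator_def by (intro tendsto_intros)
    also have "exp (\<theta> * t) * ou_mean t \<theta> \<mu> x0 - \<mu> * exp (\<theta> * t) * (1 - exp (- \<theta> * t)) = x0"
      by (simp add: ou_mean_def algebra_simps exp_minus)
    finally show ?case .
  qed
qed

lemma sample_estimator_measurable [measurable]:
  "sample_estimator t \<theta> \<mu> n \<in> borel_measurable borel"
  unfolding sample_estimator_def by measurable

lemma real_or_measurable [measurable]: "real_or c \<in> borel_measurable borel"
  unfolding real_or_def by measurable

lemma T_liminf_measurable: "T_liminf c t \<theta> \<mu> \<in> borel_measurable borel"
  unfolding T_liminf_def by measurable

lemma T_limsup_measurable: "T_limsup c t \<theta> \<mu> \<in> borel_measurable borel"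
  unfolding T_limsup_def by measurable

text \<open>At a convergent sequence the lower limit is the finite limit itself, so
  \<open>real_or\<close> returns it and not the default \<open>c\<close>.\<close>

lemma T_liminf_eq:
  assumes "(\<lambda>n. sample_estimator t \<theta> \<mu> n z) \<longlonglongrightarrow> x"
  shows "T_liminf c t \<theta> \<mu> z = x"
proof -
  have "(\<lambda>n. ereal (sample_estimator t \<theta> \<mu> n z)) \<longlonglongrightarrow> ereal x"
    using assms by simp
  then have "liminf (\<lambda>n. ereal (sample_estimator t \<theta> \<mu> n z)) = ereal x"
    by (intro lim_imp_Liminf) auto
  then show ?thesis by (simp add: T_liminf_def real_or_def)
qed

lemma T_limsup_eq:
  assumes "(\<lambda>n. sample_estimator t \<theta> \<mu> n z) \<longlonglongrightarrow> x"
  shows "T_limsup c t \<theta> \<mu> z = x"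
proof -
  have "(\<lambda>n. ereal (sample_estimator t \<theta> \<mu> n z)) \<longlonglongrightarrow> ereal x"
    using assms by simp
  then have "limsup (\<lambda>n. ereal (sample_estimator t \<theta> \<mu> n z)) = ereal x"
    by (intro lim_imp_Limsup) auto
  then show ?thesis by (simp add: T_limsup_def real_or_def)
qed

text \<open>Measurability of \<open>T\<close> makes each level set an event, which turns almost sure
  equality into probability exactly 1.\<close>

lemma infinite_sample_consistentI:
  assumes \<gamma>: "\<And>p. borel_prob_measure (\<gamma> p)"
    and T: "T \<in> borel_measurable borel"
    and AE: "\<And>p. AE z in infinite_power (\<gamma> p). T z = p"
  shows "infinite_sample_consistent \<gamma> T"
proof -
  have "emeasure (infinite_power (\<gamma> p)) {z. T z = p} = 1" for p
  proof -
    have sets: "sets (infinite_power (\<gamma> p)) = sets borel"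
      using \<gamma> by (intro sets_infinite_power) (simp add: borel_prob_measure_def)
    interpret P: prob_space "infinite_power (\<gamma> p)"
      using \<gamma> by (intro prob_space_infinite_power) (simp add: borel_prob_measure_def)
    have "{z. T z = p} = T -` {p} \<inter> space borel" by auto
    also have "\<dots> \<in> sets borel" using T by (rule measurable_sets) simp
    finally have "{z. T z = p} \<in> sets (infinite_power (\<gamma> p))" by (simp only: sets)
    then show ?thesis using AE by (intro P.emeasure_eq_1_AE) auto
  qed
  then show ?thesis using \<gamma> T by (simp add: infinite_sample_consistent_def)
qed

theorem theorem3p1p1:
  fixes t \<theta> \<mu> \<sigma> c :: real
  assumes "t > 0" and "\<theta> > 0" and "\<sigma> > 0"
  shows "infinite_sample_consistent (ou_law t \<theta> \<mu> \<sigma>) (T_liminf c t \<theta> \<mu>) \<and>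
         infinite_sample_consistent (ou_law t \<theta> \<mu> \<sigma>) (T_limsup c t \<theta> \<mu>)"
proof -
  have \<gamma>: "borel_prob_measure (ou_law t \<theta> \<mu> \<sigma> p)" for p
    using ou_variance_pos[OF assms]
    by (simp add: borel_prob_measure_def ou_law_def prob_space_gaussian_measure)
  note lim = sample_estimator_AE_tendsto[OF assms]
  show ?thesis
  proof
    show "infinite_sample_consistent (ou_law t \<theta> \<mu> \<sigma>) (T_liminf c t \<theta> \<mu>)"
      using \<gamma> T_liminf_measurable
      \<comment> \<open>The estimator equals the parameter wherever the finite-sample estimators
        converge to it, hence almost surely.\<close>
      by (rule infinite_sample_consistentI) (rule eventually_mono[OF lim T_liminf_eq])
    show "infinite_sample_consistent (ou_law t \<theta> \<mu> \<sigma>) (T_limsup c t \<theta> \<mu>)"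
      using \<gamma> T_limsup_measurable
      by (rule infinite_sample_consistentI) (rule eventually_mono[OF lim T_limsup_eq])
  qed
qed

end
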